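(* Let $a,b$ be integers and $n$ a positive integer. Then the lattice width of the tetrahedron $T_{a,b,n}$ is at most $2\lceil n^{1/3}\rceil$.
   Context: $T_{a,b,n}$ is the tetrahedron with vertices $(0,0,0),(1,0,0),(0,1,0),(a,b,n)$ (no cleanness assumption). For a lattice polytope $S\subset\mathbb{R}^3$ and $u\in\mathbb{Z}^3$, the $u$-width of $S$ is $\max\{u\cdot x:x\in S\}-\min\{u\cdot x:x\in S\}$, and the lattice width of $S$ is the minimum of the $u$-widths over all $u\in\mathbb{Z}^3\setminus\{0\}$. *)

theory Defs
  imports "HOL-Analysis.Analysis"
begin

definition of_int_vec :: "int ^ 'n \<Rightarrow> real ^ 'n" where
  "of_int_vec u = (\<chi> i. real_of_int (u $ i))"

definition lattice_polytope :: "(real ^ 'n) set \<Rightarrow> bool" where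
  "lattice_polytope S \<longleftrightarrow>
     (\<exists>V. finite V \<and> V \<noteq> {} \<and> V \<subseteq> range of_int_vec \<and> S = convex hull V)"

text \<open>For polytopes the supremum and infimum below are attained (\<open>u_width_attained\<close>), and so is the
  infimum over all nonzero directions for lattice polytopes (\<open>lattice_width_attained\<close>).\<close>

definition u_width :: "int ^ 'n \<Rightarrow> (real ^ 'n) set \<Rightarrow> real" where
  "u_width u S = (SUP x\<in>S. of_int_vec u \<bullet> x) - (INF x\<in>S. of_int_vec u \<bullet> x)"

definition lattice_width :: "(real ^ 'n) set \<Rightarrow> real" where
  "lattice_width S = (INF u\<in>{u. u \<noteq> 0}. u_width u S)"

definition tetrahedron :: "int \<Rightarrow> int \<Rightarrow> int \<Rightarrow> (real ^ 3) set" where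
  "tetrahedron a b n = convex hull
     {vector [0, 0, 0], vector [1, 0, 0], vector [0, 1, 0],
      vector [real_of_int a, real_of_int b, real_of_int n]}"

lemma u_width_attained:
  assumes "compact S" "S \<noteq> {}"
  obtains x y where "x \<in> S" "y \<in> S"
    "\<And>z. z \<in> S \<Longrightarrow> of_int_vec u \<bullet> z \<le> of_int_vec u \<bullet> x"
    "\<And>z. z \<in> S \<Longrightarrow> of_int_vec u \<bullet> y \<le> of_int_vec u \<bullet> z"
    "u_width u S = of_int_vec u \<bullet> x - of_int_vec u \<bullet> y"
proof -
  have c: "continuous_on S (\<lambda>x. of_int_vec u \<bullet> x)"
    by (intro continuous_intros)
  obtain x where x: "x \<in> S" "\<And>z. z \<in> S \<Longrightarrow> of_int_vec u \<bullet> z \<le> of_int_vec u \<bullet> x"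
    using continuous_attains_sup[OF assms c] by blast
  obtain y where y: "y \<in> S" "\<And>z. z \<in> S \<Longrightarrow> of_int_vec u \<bullet> y \<le> of_int_vec u \<bullet> z"
    using continuous_attains_inf[OF assms c] by blast
  have "(SUP z\<in>S. of_int_vec u \<bullet> z) = of_int_vec u \<bullet> x"
    using x by (intro cSup_eq_maximum) auto
  moreover have "(INF z\<in>S. of_int_vec u \<bullet> z) = of_int_vec u \<bullet> y"
    using y by (intro cInf_eq_minimum) auto
  ultimately show thesis
    using x y that by (simp add: u_width_def)
qed

lemma u_width_Nats:
  assumes "lattice_polytope S"
  shows "u_width u S \<in> \<nat>"
proof -
  obtain V where V: "finite V" "V \<noteq> {}" "V \<subseteq> range of_int_vec" "S = convex hull V"
    using assms unfolding lattice_polytope_def by blast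
  let ?f = "\<lambda>x. of_int_vec u \<bullet> x"
  have im: "?f ` S = convex hull (?f ` V)"
    unfolding V(4) by (rule convex_hull_linear_image) (simp add: bounded_linear.linear bounded_linear_inner_right)
  have fin: "finite (?f ` V)" "?f ` V \<noteq> {}" using V by auto
  have int: "t \<in> \<int>" if t: "t \<in> ?f ` V" for t
  proof -
    obtain v where "t = of_int_vec u \<bullet> of_int_vec v" using t V(3) by blast
    then show ?thesis by (auto simp: of_int_vec_def inner_vec_def intro!: Ints_sum Ints_mult)
  qed
  have sub1: "convex hull (?f ` V) \<subseteq> {..Max (?f ` V)}"
    using fin by (intro hull_minimal) auto
  have sub2: "convex hull (?f ` V) \<subseteq> {Min (?f ` V)..}"
    using fin by (intro hull_minimal) auto
  have "Sup (?f ` S) = Max (?f ` V)"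
    unfolding im using sub1 Max_in[OF fin] by (intro cSup_eq_maximum) (auto intro: hull_inc)
  moreover have "Inf (?f ` S) = Min (?f ` V)"
    unfolding im using sub2 Min_in[OF fin] by (intro cInf_eq_minimum) (auto intro: hull_inc)
  ultimately have w: "u_width u S = Max (?f ` V) - Min (?f ` V)"
    by (simp add: u_width_def)
  have "Min (?f ` V) \<le> Max (?f ` V)"
    using Max_ge[OF fin(1) Min_in[OF fin]] .
  then show ?thesis
    unfolding w using int[OF Max_in[OF fin]] int[OF Min_in[OF fin]] by (simp add: Nats_altdef2)
qed

lemma lattice_width_attained:
  fixes S :: "(real ^ 'n) set"
  assumes "lattice_polytope S"
  obtains u where "u \<noteq> 0" "lattice_width S = u_width u S"
    "\<And>v. v \<noteq> 0 \<Longrightarrow> u_width u S \<le> u_width v S"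
proof -
  define w where "w = (\<lambda>u. nat \<lfloor>u_width u S\<rfloor>)"
  have w: "u_width u S = real (w u)" for u
    using u_width_Nats[OF assms, of u] by (auto simp: w_def elim!: Nats_cases)
  have "(1 :: int ^ 'n) \<noteq> 0" by (simp add: vec_eq_iff)
  then obtain u where u: "u \<noteq> 0" "\<And>v. v \<noteq> 0 \<Longrightarrow> w u \<le> w v"
    using ex_has_least_nat[of "\<lambda>u :: int ^ 'n. u \<noteq> 0" 1 w] by blast
  have "lattice_width S = u_width u S"
    unfolding lattice_width_def using u by (intro cInf_eq_minimum) (auto simp: w)
  with u that show thesis by (simp add: w)
qed

lemma lattice_polytope_tetrahedron: "lattice_polytope (tetrahedron a b n)"
proof -
  have v: "vector [real_of_int p, real_of_int q, real_of_int r] \<in> range (of_int_vec :: int ^ 3 \<Rightarrow> _)" for p q r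
    by (rule range_eqI[of _ _ "vector [p, q, r]"]) (simp add: of_int_vec_def vec_eq_iff forall_3)
  show ?thesis
    unfolding lattice_polytope_def tetrahedron_def
    using v[of 0 0 0] v[of 1 0 0] v[of 0 1 0] v[of a b n]
    by (intro exI[of _ "{vector [0, 0, 0], vector [1, 0, 0], vector [0, 1, 0],
      vector [real_of_int a, real_of_int b, real_of_int n]}"]) auto
qed

end

theory Submission
  imports Defs
begin

text \<open>On the four vertices a direction \<open>(x, y, z)\<close> takes the values \<open>0\<close>, \<open>x\<close>, \<open>y\<close> and
  \<open>t = a x + b y + n z\<close>, and the triples \<open>(x, y, t)\<close> that occur are those with
  \<open>t \<equiv> a x + b y\<close> modulo \<open>n\<close>. If \<open>k\<^sup>3 \<ge> n\<close> then \<open>{0..k}\<^sup>3\<close> has more than \<open>n\<close> elements, so two of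
  them have the same residue \<open>t - a x - b y\<close> modulo \<open>n\<close>. Their difference is a nonzero triple of
  the required kind with entries in \<open>[-k, k]\<close>, which gives width at most \<open>2 k\<close>.\<close>

lemma ex_small_linear_form:
  fixes a b n k :: int
  assumes "n > 0" "k \<ge> 0" "n \<le> k ^ 3"
  obtains x y z where "(x, y, z) \<noteq> (0, 0, 0)"
    "\<bar>x\<bar> \<le> k" "\<bar>y\<bar> \<le> k" "\<bar>a * x + b * y + n * z\<bar> \<le> k"
proof -
  define A where "A = {0..k} \<times> {0..k} \<times> {0..k}"
  define f where "f = (\<lambda>(x, y, t). (t - a * x - b * y) mod n)"
  have "n < (k + 1) ^ 3"
    using assms power_strict_mono[of k "k + 1" 3] by simp
  moreover have "int (card A) = (k + 1) ^ 3"
    using \<open>k \<ge> 0\<close> by (simp add: A_def card_cartesian_product power3_eq_cube)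
  ultimately have card: "card {0..<n} < card A"
    using \<open>n > 0\<close> by simp
  have "f ` A \<subseteq> {0..<n}"
    using \<open>n > 0\<close> by (auto simp: f_def)
  then have "card (f ` A) < card A"
    using card card_mono[of "{0..<n}" "f ` A"] by simp
  then have "\<not> inj_on f A"
    by (rule pigeonhole)
  then obtain p q where pq: "p \<in> A" "q \<in> A" "f p = f q" "p \<noteq> q"
    unfolding inj_on_def by blast
  obtain x y t x' y' t' where p: "p = (x, y, t)" and q: "q = (x', y', t')"
    by (metis prod_cases3)
  have "n dvd (t - a * x - b * y) - (t' - a * x' - b * y')"
    using pq(3) by (simp add: f_def p q mod_eq_dvd_iff)
  then obtain z where "(t - a * x - b * y) - (t' - a * x' - b * y') = n * z" ..
  then have z: "a * (x - x') + b * (y - y') + n * z = t - t'"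
    by (simp add: algebra_simps)
  show thesis
  proof (rule that)
    \<comment> \<open>If all three entries vanish, the equation \<open>z\<close> forces
      \<open>t = t'\<close> and hence \<open>p = q\<close>.\<close>
    show "(x - x', y - y', z) \<noteq> (0, 0, 0)"
      using z pq(4) by (auto simp: p q)
    show "\<bar>a * (x - x') + b * (y - y') + n * z\<bar> \<le> k"
      unfolding z using pq(1,2) by (auto simp: A_def p q)
  qed (use pq(1,2) in \<open>auto simp: A_def p q\<close>)
qed

text \<open>The infimum over all directions is attained, so it is a minimum and bounds every width
  from below.\<close>

lemma lattice_width_le_u_width:
  assumes "lattice_polytope S" "u \<noteq> 0"
  shows "lattice_width S \<le> u_width u S"
  using assms lattice_width_attained by metis

text \<open>The slab where the form is at most \<open>c\<close> in absolute value is convex, so it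
  contains the hull once it contains \<open>V\<close>.\<close>

lemma u_width_convex_hull_le:
  assumes "finite V" "V \<noteq> {}" "\<And>v. v \<in> V \<Longrightarrow> \<bar>of_int_vec u \<bullet> v\<bar> \<le> c"
  shows "u_width u (convex hull V) \<le> 2 * c"
proof -
  have le: "convex hull V \<subseteq> {z. of_int_vec u \<bullet> z \<le> c}"
    using assms(3) by (intro hull_minimal convex_halfspace_le) force
  have ge: "convex hull V \<subseteq> {z. of_int_vec u \<bullet> z \<ge> - c}"
    using assms(3) by (intro hull_minimal convex_halfspace_ge) force
  obtain x y where "x \<in> convex hull V" "y \<in> convex hull V"
    "u_width u (convex hull V) = of_int_vec u \<bullet> x - of_int_vec u \<bullet> y"
    using u_width_attained[of "convex hull V" u] assms(1,2)
    by (metis convex_hull_eq_empty finite_imp_compact_convex_hull)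
  then show ?thesis
    using le ge by force
qed

theorem theorem16:
  fixes a b n :: int
  assumes "n > 0"
  shows "lattice_width (tetrahedron a b n) \<le> real_of_int (2 * \<lceil>real_of_int n powr (1 / 3)\<rceil>)"
proof -
  define k where "k = \<lceil>real_of_int n powr (1 / 3)\<rceil>"
  have le_k: "real_of_int n powr (1 / 3) \<le> real_of_int k"
    by (simp add: k_def)
  have "real_of_int n = (real_of_int n powr (1 / 3)) ^ 3"
    using assms by (simp add: powr_power)
  also have "\<dots> \<le> real_of_int k ^ 3"
    using le_k by (intro power_mono) auto
  finally have "n \<le> k ^ 3"
    by (metis of_int_le_iff of_int_power)
  moreover have "k \<ge> 0"
    using order_trans[OF powr_ge_zero le_k] by simp
  ultimately obtain x y z where xyz: "(x, y, z) \<noteq> (0, 0, 0)"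
    "\<bar>x\<bar> \<le> k" "\<bar>y\<bar> \<le> k" "\<bar>a * x + b * y + n * z\<bar> \<le> k"
    using ex_small_linear_form assms by metis
  define u :: "int ^ 3" where "u = vector [x, y, z]"
  have "u \<noteq> 0"
    using xyz(1) by (auto simp: u_def vec_eq_iff forall_3)
  have inner: "of_int_vec u \<bullet> vector [p, q, r] = x * p + y * q + z * r" for p q r :: real
    by (simp add: of_int_vec_def u_def inner_vec_def sum_3)
  have "\<bar>real_of_int (a * x + b * y + n * z)\<bar> \<le> real_of_int k"
    using xyz(4) by linarith
  \<comment> \<open>The origin has value 0, which is where \<open>k \<ge> 0\<close> enters; the
    other vertices have values \<open>x\<close>, \<open>y\<close> and
    \<open>a * x + b * y + n * z\<close>.\<close>
  then have "u_width u (tetrahedron a b n) \<le> 2 * real_of_int k"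
    unfolding tetrahedron_def using xyz(2,3) \<open>k \<ge> 0\<close>
    by (intro u_width_convex_hull_le) (auto simp: inner mult.commute)
  then show ?thesis
    using lattice_width_le_u_width[OF lattice_polytope_tetrahedron \<open>u \<noteq> 0\<close>, of a b n]
    by (simp add: k_def)
qed

end
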